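(* Suppose $U\in U(N)$ is a local maximizer over the unitary group $U(N)$ of $\|V\|_1=\sum_{i,j}|V_{ij}|$. Then all entries of $U$ are nonzero: $U_{ij}\neq0$ for all $i,j$. *)

theory Defs
  imports "HOL-Analysis.Analysis"
begin

definition conj_transpose :: "complex^'n^'m \<Rightarrow> complex^'m^'n" where
  "conj_transpose A = (\<chi> i j. cnj (A $ j $ i))"

definition unitary_group :: "(complex^'n^'n) set" where
  "unitary_group = {U. conj_transpose U ** U = mat 1 \<and> U ** conj_transpose U = mat 1}"

(* The library norm on "complex^'n^'m" is the Frobenius norm, not this entrywise one. *)
definition norm1 :: "complex^'n^'m \<Rightarrow> real" where
  "norm1 A = (\<Sum>i\<in>UNIV. \<Sum>j\<in>UNIV. cmod (A $ i $ j))"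

definition local_maximizer_on :: "('a::topological_space \<Rightarrow> 'b::order) \<Rightarrow> 'a set \<Rightarrow> 'a \<Rightarrow> bool" where
  "local_maximizer_on f S x \<longleftrightarrow>
     x \<in> S \<and> (\<exists>W. open W \<and> x \<in> W \<and> (\<forall>y\<in>S \<inter> W. f y \<le> f x))"

end

theory Submission
  imports Defs
begin

text \<open>
  If \<open>U\<^sub>i\<^sub>j = 0\<close>, pick a row \<open>k\<close> with \<open>U\<^sub>k\<^sub>j \<noteq> 0\<close> and rotate rows \<open>i\<close> and \<open>k\<close> into each other by
  an angle \<open>\<plusminus>t\<close>. Averaging the norm over both signs, the triangle inequality bounds the loss in
  every column by a factor \<open>cos t\<close>, that is by \<open>O(t\<^sup>2)\<close>, whereas column \<open>j\<close> gains
  \<open>\<bar>sin t\<bar> \<bar>U\<^sub>k\<^sub>j\<bar>\<close>. So one of the two signs increases the norm for every small \<open>t > 0\<close>.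
\<close>

definition rotate_rows :: "'m \<Rightarrow> 'm \<Rightarrow> real \<Rightarrow> complex^'n^'m \<Rightarrow> complex^'n^'m" where
  "rotate_rows i k t A = (\<chi> p.
     if p = i then cos t *\<^sub>R A $ i + sin t *\<^sub>R A $ k
     else if p = k then cos t *\<^sub>R A $ k - sin t *\<^sub>R A $ i
     else A $ p)"

text \<open>For square matrices a one-sided inverse is two-sided, so orthonormality of the rows
  suffices. This form suits an operation that mixes only two rows.\<close>

lemma unitary_group_iff_rows:
  fixes U :: "complex^'n^'n"
  shows "U \<in> unitary_group \<longleftrightarrow>
    (\<forall>p q. (\<Sum>j\<in>UNIV. U $ p $ j * cnj (U $ q $ j)) = (if p = q then 1 else 0))"
proof -
  have "U \<in> unitary_group \<longleftrightarrow> U ** conj_transpose U = mat 1"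
    unfolding unitary_group_def using matrix_left_right_inverse by blast
  then show ?thesis
    by (simp add: vec_eq_iff matrix_matrix_mult_def conj_transpose_def mat_def)
qed

lemma rotate_rows_unitary:
  fixes U :: "complex^'n^'n"
  assumes "U \<in> unitary_group" "i \<noteq> k"
  shows "rotate_rows i k t U \<in> unitary_group"
proof -
  define ip where "ip x y = (\<Sum>j\<in>UNIV. x $ j * cnj (y $ j))" for x y :: "complex^'n"
  \<comment> \<open>Only real scalars occur in the rotation, so the conjugation in the second
    argument of \<open>ip\<close> leaves them unchanged.\<close>
  have lin: "ip (x + y) z = ip x z + ip y z" "ip (x - y) z = ip x z - ip y z"
    "ip z (x + y) = ip z x + ip z y" "ip z (x - y) = ip z x - ip z y"
    "ip (r *\<^sub>R x) z = of_real r * ip x z" "ip z (r *\<^sub>R x) = of_real r * ip z x"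
    for x y z r
    by (simp_all add: ip_def algebra_simps sum.distrib sum_subtractf sum_distrib_left
        scaleR_conv_of_real[where 'a = complex])
  have orth: "ip (U $ p) (U $ q) = (if p = q then 1 else 0)" for p q
    using assms(1) by (simp add: unitary_group_iff_rows ip_def)
  have sc: "complex_of_real (sin t) * of_real (sin t) + of_real (cos t) * of_real (cos t) = 1"
    by (metis of_real_1 of_real_add of_real_mult power2_eq_square sin_cos_squared_add)
  have "ip (rotate_rows i k t U $ p) (rotate_rows i k t U $ q) = (if p = q then 1 else 0)" for p q
    using assms(2) sc by (auto simp: rotate_rows_def lin orth algebra_simps)
  then show ?thesis
    by (simp add: unitary_group_iff_rows ip_def)
qed

lemma tendsto_rotate_rows: "((\<lambda>t. rotate_rows i k t A) \<longlongrightarrow> A) (at 0)"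
proof -
  have "((\<lambda>t. rotate_rows i k t A $ p) \<longlongrightarrow> A $ p) (at 0)" for p
    by (cases "p = i"; cases "p = k") (auto simp: rotate_rows_def intro!: tendsto_eq_intros)
  then show ?thesis
    by (rule vec_tendstoI)
qed

text \<open>Applied with \<open>z\<close> a cosine term and \<open>w\<close> a sine term: replacing
  t by -t flips only the sign of \<open>w\<close>, so in the sum over both signs the sine terms cost
  nothing.\<close>

lemma cmod_add_diff_ge: "2 * cmod z \<le> cmod (z + w) + cmod (z - w)"
proof -
  have "cmod (2 * z) \<le> cmod (z + w) + cmod (z - w)"
    using norm_triangle_ineq[of "z + w" "z - w"] by simp
  then show ?thesis
    by (simp add: norm_mult)
qed

lemma norm1_rotate_rows_sum_ge:
  fixes A :: "complex^'n^'m"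
  assumes "i \<noteq> k" "A $ i $ j = 0"
  defines "F \<equiv> (\<Sum>l\<in>UNIV. cmod (A $ i $ l) + cmod (A $ k $ l))"
  shows "2 * (norm1 A - F + (cos t * F + sin t * cmod (A $ k $ j)))
    \<le> norm1 (rotate_rows i k t A) + norm1 (rotate_rows i k (- t) A)"
proof -
  define R where "R B = (\<Sum>p\<in>UNIV - {i, k}. \<Sum>l\<in>UNIV. cmod (B $ p $ l))" for B :: "complex^'n^'m"
  have split: "norm1 B = (\<Sum>l\<in>UNIV. cmod (B $ i $ l) + cmod (B $ k $ l)) + R B" for B :: "complex^'n^'m"
  proof -
    have "norm1 B = R B + (\<Sum>p\<in>{i, k}. \<Sum>l\<in>UNIV. cmod (B $ p $ l))"
      unfolding norm1_def R_def by (rule sum.subset_diff) auto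
    then show ?thesis
      using assms(1) by (simp add: sum.distrib)
  qed
  have R: "R (rotate_rows i k s A) = R A" for s
    unfolding R_def by (intro sum.cong) (auto simp: rotate_rows_def)
  define g where "g s l = cmod (cos s *\<^sub>R A $ i $ l + sin s *\<^sub>R A $ k $ l)
    + cmod (cos s *\<^sub>R A $ k $ l - sin s *\<^sub>R A $ i $ l)" for s l
  have norm1_rot: "norm1 (rotate_rows i k s A) = (\<Sum>l\<in>UNIV. g s l) + R A" for s
    using assms(1) unfolding split R g_def by (simp add: rotate_rows_def)
  have col: "2 * (cos t * (cmod (A $ i $ l) + cmod (A $ k $ l)) + (if l = j then sin t * cmod (A $ k $ j) else 0))
      \<le> g t l + g (- t) l" for l
  proof -
    \<comment> \<open>The sign of \<open>cos t\<close> is not restricted, and taking moduli produces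
      its absolute value.\<close>
    have "cos t * x \<le> \<bar>cos t\<bar> * x" if "x \<ge> 0" for x
      using that by (simp add: mult_right_mono)
    from this[of "cmod (A $ i $ l)"] this[of "cmod (A $ k $ l)"]
    have cos: "cos t * cmod (A $ i $ l) \<le> \<bar>cos t\<bar> * cmod (A $ i $ l)"
      "cos t * cmod (A $ k $ l) \<le> \<bar>cos t\<bar> * cmod (A $ k $ l)"
      by simp_all
    show ?thesis
    proof (cases "l = j")
      \<comment> \<open>Since \<open>A $ i $ j = 0\<close>, the two rotated entries are plain
        multiples of \<open>A $ k $ j\<close>, by \<plusminus>sin t and cos t. Their moduli are
        known exactly, and the sine part is the gain.\<close>
      case True
      have "sin t * cmod (A $ k $ j) \<le> \<bar>sin t\<bar> * cmod (A $ k $ j)"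
        by (simp add: mult_right_mono)
      with True cos assms(2) show ?thesis
        by (simp add: g_def)
    next
      case False
      \<comment> \<open>The four moduli regroup by row: the two versions of the entry in row
        \<open>i\<close> form one sum/difference pair, those in row \<open>k\<close> the
        other.\<close>
      with cos cmod_add_diff_ge[of "cos t *\<^sub>R A $ i $ l" "sin t *\<^sub>R A $ k $ l"]
        cmod_add_diff_ge[of "cos t *\<^sub>R A $ k $ l" "sin t *\<^sub>R A $ i $ l"]
      show ?thesis
        by (simp add: g_def algebra_simps)
    qed
  qed
  have "2 * (cos t * F + sin t * cmod (A $ k $ j)) =
    (\<Sum>l\<in>UNIV. 2 * (cos t * (cmod (A $ i $ l) + cmod (A $ k $ l)) + (if l = j then sin t * cmod (A $ k $ j) else 0)))"
    unfolding F_def sum_distrib_left[symmetric] sum.distrib by simp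
  also have "\<dots> \<le> (\<Sum>l\<in>UNIV. g t l + g (- t) l)"
    by (intro sum_mono col)
  finally show ?thesis
    unfolding norm1_rot split[of A] F_def[symmetric] by (simp add: sum.distrib)
qed

theorem theorem1p6:
  fixes U :: "complex^'n^'n"
  assumes "local_maximizer_on norm1 unitary_group U"
  shows "\<forall>i j. U $ i $ j \<noteq> 0"
proof (intro allI notI)
  fix i j
  assume zero: "U $ i $ j = 0"
  obtain W where U: "U \<in> unitary_group" and W: "open W" "U \<in> W"
    and max: "\<And>V. V \<in> unitary_group \<Longrightarrow> V \<in> W \<Longrightarrow> norm1 V \<le> norm1 U"
    using assms unfolding local_maximizer_on_def by blast
  \<comment> \<open>Column \<open>j\<close> has unit length, hence a nonzero entry.\<close>
  have "(conj_transpose U ** U) $ j $ j = 1"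
    using U by (simp add: unitary_group_def mat_def)
  then have "(\<Sum>k\<in>UNIV. cnj (U $ k $ j) * U $ k $ j) \<noteq> 0"
    by (simp add: matrix_matrix_mult_def conj_transpose_def)
  then obtain k where k: "U $ k $ j \<noteq> 0"
    using sum.not_neutral_contains_not_neutral by fastforce
  with zero have "i \<noteq> k"
    by auto
  define F where "F = (\<Sum>l\<in>UNIV. cmod (U $ i $ l) + cmod (U $ k $ l))"
  define h where "h t = cos t * F + sin t * cmod (U $ k $ j)" for t
  \<comment> \<open>At 0 the cosine is stationary, so only the sine term contributes to the slope,
    while \<open>h 0 = F\<close>.\<close>
  have "(h has_real_derivative cmod (U $ k $ j)) (at 0)"
    unfolding h_def by (auto intro!: derivative_eq_intros)
  then obtain d where "d > 0" and d: "\<And>t. 0 < t \<Longrightarrow> t < d \<Longrightarrow> h 0 < h t"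
    using DERIV_pos_inc_right[of h "cmod (U $ k $ j)" 0] k by auto
  have "\<forall>\<^sub>F t in at 0. rotate_rows i k t U \<in> W"
    using tendsto_rotate_rows W by (rule topological_tendstoD)
  then obtain e where "e > 0"
    and e: "\<And>t. t \<noteq> 0 \<Longrightarrow> \<bar>t\<bar> < e \<Longrightarrow> rotate_rows i k t U \<in> W"
    by (auto simp: eventually_at dist_real_def)
  \<comment> \<open>Small enough that \<open>h\<close> has increased at \<open>t\<close> and that
    both rotations, by \<open>t\<close> and by \<open>-t\<close>, stay in \<open>W\<close>.\<close>
  define t where "t = min d e / 2"
  have t: "0 < t" "t < d" "t < e"
    using \<open>d > 0\<close> \<open>e > 0\<close> by (auto simp: t_def)
  have "norm1 (rotate_rows i k s U) \<le> norm1 U" if "s \<noteq> 0" "\<bar>s\<bar> < e" for s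
    using max rotate_rows_unitary[OF U \<open>i \<noteq> k\<close>] e that by blast
  from this[of t] this[of "- t"]
  have "norm1 (rotate_rows i k t U) + norm1 (rotate_rows i k (- t) U) \<le> 2 * norm1 U"
    using t by simp
  moreover have "F < h t"
    using d[of t] t by (simp add: h_def)
  \<comment> \<open>The lower bound on the sum is 2 * (\<open>norm1 U\<close> - \<open>F\<close> +
    \<open>h t\<close>), which exceeds 2 * \<open>norm1 U\<close>.\<close>
  ultimately show False
    using norm1_rotate_rows_sum_ge[of i k U j t, OF \<open>i \<noteq> k\<close> zero]
    unfolding F_def[symmetric] h_def by simp
qed

end
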